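(* No algorithm can output the multiplicative inverse of an arbitrary (nonzero) computable $\mathbf{x}\in\mathbb{R}_c^{\mathbb{Z}_{<}}$.
   Context: $\mathbb{R}^{\mathbb{Z}_{<}}$ is the field of all two-sided real sequences $\mathbf{x}=(x_n)_{n\in\mathbb{Z}}$ for which there exists $N$ with $x_n=0$ for all $n<-N$, with componentwise addition and Cauchy convolution $(\mathbf{x}\cdot\mathbf{y})_n=\sum_{k\in\mathbb{Z}}x_k y_{n-k}$ as multiplication; the multiplicative identity has entry $1$ at index $0$ and $0$ elsewhere. A real number is computable if its binary expansion can be output by a Turing machine; $\mathbb{R}_c$ is the set of computable reals. An element $\mathbf{z}\in\mathbb{R}^{\mathbb{Z}_{<}}$ is computable if there is a computable map $f:\mathbb{Z}\to\mathbb{R}_c$ with $\mathbf{z}_n=f(n)$ for all $n$, and the set $\{n<0:f(n)\ne 0\}$ is finite with a known bound. $\mathbb{R}_c^{\mathbb{Z}_{<}}$ is the set of computable elements. A computable element is given to, or output by, an algorithm as a program which on input $(n,p)$ returns a rational within $2^{-p}$ of the coefficient $\mathbf{z}_n$, together with an $N$ such that $\mathbf{z}_n=0$ for all $n<-N$. *)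

theory Defs
  imports
    Complex_Main
    "HOL-Library.Nat_Bijection"
    "HOL-Computational_Algebra.Formal_Laurent_Series"
begin

text \<open>
  Algorithms are the partial recursive functions on the natural numbers, presented as a
  programming language whose programs are unary. Several arguments are passed as one number
  via \<^const>\<open>prod_encode\<close>, integers via \<^const>\<open>int_encode\<close>.
\<close>

datatype prog =
    Zero
  | Succ
  | Fst
  | Snd
  | Fork prog prog
  | Comp prog prog
  | Prec prog prog
  | Mn prog

text \<open>
  The result \<^term>\<open>None\<close> means that the program does not halt. \<^const>\<open>Prec\<close> is primitive
  recursion on the second component of the input, with base case \<open>f\<close> and step function \<open>g\<close>;
  \<^const>\<open>Mn\<close> is unbounded search, which diverges if some value of \<open>f\<close> needed before the first
  zero is undefined.
\<close>

primrec run :: "prog \<Rightarrow> nat \<Rightarrow> nat option" where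
  "run Zero x = Some 0"
| "run Succ x = Some (Suc x)"
| "run Fst x = Some (fst (prod_decode x))"
| "run Snd x = Some (snd (prod_decode x))"
| "run (Fork f g) x =
     Option.bind (run f x) (\<lambda>a. Option.bind (run g x) (\<lambda>b. Some (prod_encode (a, b))))"
| "run (Comp f g) x = Option.bind (run g x) (run f)"
| "run (Prec f g) x =
     (case prod_decode x of (a, n) \<Rightarrow>
        rec_nat (run f a)
          (\<lambda>k r. Option.bind r (\<lambda>v. run g (prod_encode (a, prod_encode (k, v))))) n)"
| "run (Mn f) x =
     (if \<exists>n. run f (prod_encode (x, n)) = Some 0 \<and>
             (\<forall>k<n. run f (prod_encode (x, k)) \<noteq> None)
      then Some (LEAST n. run f (prod_encode (x, n)) = Some 0)
      else None)"

text \<open>An injective numbering, which lets programs be given to and output by programs.\<close>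

primrec encode_prog :: "prog \<Rightarrow> nat" where
  "encode_prog Zero = prod_encode (0, 0)"
| "encode_prog Succ = prod_encode (1, 0)"
| "encode_prog Fst = prod_encode (2, 0)"
| "encode_prog Snd = prod_encode (3, 0)"
| "encode_prog (Fork f g) = prod_encode (4, prod_encode (encode_prog f, encode_prog g))"
| "encode_prog (Comp f g) = prod_encode (5, prod_encode (encode_prog f, encode_prog g))"
| "encode_prog (Prec f g) = prod_encode (6, prod_encode (encode_prog f, encode_prog g))"
| "encode_prog (Mn f) = prod_encode (7, encode_prog f)"

lemma encode_prog_inject: "encode_prog p = encode_prog q \<Longrightarrow> p = q"
proof (induction p arbitrary: q)
  case Zero then show ?case by (cases q) auto
next
  case Succ then show ?case by (cases q) auto
next
  case Fst then show ?case by (cases q) auto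
next
  case Snd then show ?case by (cases q) auto
next
  case (Fork f g) then show ?case by (cases q) auto
next
  case (Comp f g) then show ?case by (cases q) auto
next
  case (Prec f g) then show ?case by (cases q) auto
next
  case (Mn f) then show ?case by (cases q) auto
qed

definition computable_fun :: "(nat \<Rightarrow> nat) \<Rightarrow> bool" where
  "computable_fun f \<longleftrightarrow> (\<exists>p. \<forall>n. run p n = Some (f n))"

text \<open>
  The computable reals: up to sign, an integer part \<open>m\<close> followed by the binary digits
  \<open>d 0, d 1, \<dots>\<close> after the point.
\<close>

definition computable_reals :: "real set" where
  "computable_reals =
     {r. \<exists>s m d. s \<in> {-1, 1} \<and> (\<forall>k. d k \<in> {0, 1}) \<and> computable_fun d \<and>
           r = s * (real m + (\<Sum>k. real (d k) / 2 ^ Suc k))}"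

text \<open>A rational is output as numerator and predecessor of a (possibly unreduced) denominator.\<close>

definition decode_rat :: "nat \<Rightarrow> rat" where
  "decode_rat y = (case prod_decode y of (a, b) \<Rightarrow> of_int (int_decode a) / of_nat (Suc b))"

text \<open>
  The field of two-sided real sequences vanishing far to the left is \<^typ>\<open>real fls\<close>, the
  coefficient at index \<open>n\<close> of \<open>z\<close> being \<^term>\<open>fls_nth z n\<close>.
\<close>

definition represents :: "prog \<Rightarrow> nat \<Rightarrow> real fls \<Rightarrow> bool" where
  "represents p N z \<longleftrightarrow>
     (\<forall>n k. \<exists>y. run p (prod_encode (int_encode n, k)) = Some y \<and>
                \<bar>of_rat (decode_rat y) - fls_nth z n\<bar> \<le> 1 / 2 ^ k) \<and>
     (\<forall>n. n < - int N \<longrightarrow> fls_nth z n = 0)"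

definition encode_rep :: "prog \<Rightarrow> nat \<Rightarrow> nat" where
  "encode_rep p N = prod_encode (encode_prog p, N)"

definition computable_series :: "real fls set" where
  "computable_series = {z. (\<forall>n. fls_nth z n \<in> computable_reals) \<and> (\<exists>p N. represents p N z)}"

text \<open>
  The output may depend on the representation of \<open>x\<close> that is given, not only on \<open>x\<close>.
\<close>

definition computes_inverses :: "prog \<Rightarrow> bool" where
  "computes_inverses A \<longleftrightarrow>
     (\<forall>x\<in>computable_series. x \<noteq> 0 \<longrightarrow>
        (\<forall>p N. represents p N x \<longrightarrow>
           (\<exists>q M. run A (encode_rep p N) = Some (encode_rep q M) \<and>
                  represents q M (inverse x))))"

end

theory Submission
  imports Defs
begin

text \<open>
  The coefficient of \<open>X\<^sup>-\<^sup>1\<close> in \<open>1 / (a + X)\<close> is \<open>1\<close> if \<open>a = 0\<close> and \<open>0\<close> otherwise, so an inversion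
  algorithm \<open>A\<close> decides whether \<open>a = 0\<close>. A self-referential program produces such a series with
  \<open>a\<close> nonzero iff the answer of \<open>A\<close> on it is \<open>a = 0\<close>. That answer is a coefficient computed
  by the program \<open>q\<close> that \<open>A\<close> outputs, and instead of evaluating \<open>q\<close> with a universal program one
  uses \<open>A\<close> itself: from \<open>q\<close> one constructs, again by self-reference, a series on which \<open>A\<close> halts
  iff this coefficient is \<open>1\<close>. Only a step-bounded version of the single program \<open>A\<close> is needed,
  and it is obtained by recursion on the structure of \<open>A\<close>.
\<close>

section \<open>Closure properties of the computable functions\<close>

abbreviation pfst :: "nat \<Rightarrow> nat" where "pfst z \<equiv> fst (prod_decode z)"
abbreviation psnd :: "nat \<Rightarrow> nat" where "psnd z \<equiv> snd (prod_decode z)"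

lemma computable_fun_comp:
  assumes "computable_fun h" "computable_fun f"
  shows "computable_fun (\<lambda>x. h (f x))"
proof -
  obtain p q where "\<And>x. run p x = Some (h x)" "\<And>x. run q x = Some (f x)"
    using assms unfolding computable_fun_def by blast
  then have "run (Comp p q) x = Some (h (f x))" for x by simp
  then show ?thesis unfolding computable_fun_def by blast
qed

lemma computable_fun_pair:
  assumes "computable_fun f" "computable_fun g"
  shows "computable_fun (\<lambda>x. prod_encode (f x, g x))"
proof -
  obtain p q where "\<And>x. run p x = Some (f x)" "\<And>x. run q x = Some (g x)"
    using assms unfolding computable_fun_def by blast
  then have "run (Fork p q) x = Some (prod_encode (f x, g x))" for x by simp
  then show ?thesis unfolding computable_fun_def by blast
qed

lemma computable_fun_Suc: "computable_fun f \<Longrightarrow> computable_fun (\<lambda>x. Suc (f x))"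
  by (rule computable_fun_comp[of Suc]) (auto simp: computable_fun_def intro: exI[of _ Succ])

lemma computable_fun_pfst: "computable_fun f \<Longrightarrow> computable_fun (\<lambda>x. pfst (f x))"
  by (rule computable_fun_comp[of pfst]) (auto simp: computable_fun_def intro: exI[of _ Fst])

lemma computable_fun_psnd: "computable_fun f \<Longrightarrow> computable_fun (\<lambda>x. psnd (f x))"
  by (rule computable_fun_comp[of psnd]) (auto simp: computable_fun_def intro: exI[of _ Snd])

definition id_prog :: prog where "id_prog = Fork Fst Snd"

lemma run_id_prog [simp]: "run id_prog x = Some x"
  by (simp add: id_prog_def)

lemma computable_fun_id: "computable_fun (\<lambda>x. x)"
  unfolding computable_fun_def using run_id_prog by blast

primrec const_prog :: "nat \<Rightarrow> prog" where
  "const_prog 0 = Zero"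
| "const_prog (Suc n) = Comp Succ (const_prog n)"

lemma run_const_prog [simp]: "run (const_prog n) x = Some n"
  by (induction n) auto

lemma computable_fun_const: "computable_fun (\<lambda>x. c)"
  unfolding computable_fun_def using run_const_prog by blast

lemma computable_fun_rec_nat:
  assumes f: "computable_fun f"
    and g: "computable_fun (\<lambda>z. g (pfst z) (pfst (psnd z)) (psnd (psnd z)))"
    and n: "computable_fun n"
  shows "computable_fun (\<lambda>x. rec_nat (f x) (g x) (n x))"
proof -
  obtain p q where p: "\<And>x. run p x = Some (f x)"
    and q: "\<And>z. run q z = Some (g (pfst z) (pfst (psnd z)) (psnd (psnd z)))"
    using f g unfolding computable_fun_def by blast
  have "rec_nat (run p a)
          (\<lambda>k r. Option.bind r (\<lambda>v. run q (prod_encode (a, prod_encode (k, v))))) m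
        = Some (rec_nat (f a) (g a) m)" for a m
    by (induction m) (simp_all add: p q)
  then have "run (Prec p q) z = Some (rec_nat (f (pfst z)) (g (pfst z)) (psnd z))" for z
    by (simp add: case_prod_beta)
  then have "computable_fun (\<lambda>z. rec_nat (f (pfst z)) (g (pfst z)) (psnd z))"
    unfolding computable_fun_def by blast
  from computable_fun_comp[OF this computable_fun_pair[OF computable_fun_id n]]
  show ?thesis by simp
qed

text \<open>Case distinction is primitive recursion that ignores the previous value.\<close>

lemma computable_fun_case_nat:
  assumes "computable_fun f" "computable_fun (\<lambda>z. g (pfst z) (psnd z))" "computable_fun n"
  shows "computable_fun (\<lambda>x. case_nat (f x) (g x) (n x))"
proof -
  have "computable_fun (\<lambda>z. g (pfst z) (pfst (psnd z)))"
    using computable_fun_comp[OF assms(2), of "\<lambda>z. prod_encode (pfst z, pfst (psnd z))"]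
    by (simp add: computable_fun_pair computable_fun_pfst computable_fun_psnd computable_fun_id)
  then have "computable_fun (\<lambda>x. rec_nat (f x) (\<lambda>k _. g x k) (n x))"
    using assms by (intro computable_fun_rec_nat)
  moreover have "rec_nat a (\<lambda>k _. h k) m = case_nat a h m" for a :: nat and h m
    by (cases m) auto
  ultimately show ?thesis by simp
qed

lemmas computable_intros =
  computable_fun_const computable_fun_id computable_fun_Suc computable_fun_pfst
  computable_fun_psnd computable_fun_pair computable_fun_case_nat computable_fun_rec_nat

lemma computable_fun_add:
  assumes "computable_fun f" "computable_fun g"
  shows "computable_fun (\<lambda>x. f x + g x)"
proof -
  have "rec_nat a (\<lambda>_. Suc) m = a + m" for a m :: nat by (induction m) auto
  moreover have "computable_fun (\<lambda>x. rec_nat (f x) (\<lambda>_. Suc) (g x))"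
    using assms by (intro computable_intros)
  ultimately show ?thesis by simp
qed

lemma computable_fun_diff:
  assumes "computable_fun f" "computable_fun g"
  shows "computable_fun (\<lambda>x. f x - g x)"
proof -
  have "rec_nat a (\<lambda>_ v. case_nat 0 (\<lambda>m. m) v) m = a - m" for a m :: nat
    by (induction m) (auto split: nat.splits)
  moreover have "computable_fun (\<lambda>x. rec_nat (f x) (\<lambda>_ v. case_nat 0 (\<lambda>m. m) v) (g x))"
    using assms by (intro computable_intros)
  ultimately show ?thesis by simp
qed

lemma computable_fun_parity:
  assumes "computable_fun f"
  shows "computable_fun (\<lambda>x. f x mod 2)"
proof -
  have "rec_nat 0 (\<lambda>_ v. 1 - v) m = m mod 2" for m :: nat
    by (induction m) (auto simp: mod_Suc)
  moreover have "computable_fun (\<lambda>x. rec_nat 0 (\<lambda>_ v. 1 - v) (f x))"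
    using assms by (intro computable_intros computable_fun_diff)
  ultimately show ?thesis by simp
qed

section \<open>Step-bounded evaluation of a fixed program\<close>

text \<open>
  The value \<open>0\<close> means that the bound \<open>t\<close> is too small, \<open>Suc v\<close> that the result is \<open>v\<close>. In the
  search for \<^const>\<open>Mn\<close>, the state is \<open>0\<close> while searching, \<open>1\<close> after meeting an unavailable
  value, and \<open>n + 2\<close> once the zero \<open>n\<close> is found.
\<close>

abbreviation search :: "(nat \<Rightarrow> nat) \<Rightarrow> nat \<Rightarrow> nat" where
  "search h \<equiv> rec_nat 0 (\<lambda>k. case_nat (case_nat 1 (case_nat (Suc (Suc k)) (\<lambda>_. 0)) (h k)) Suc)"

primrec stepped :: "prog \<Rightarrow> nat \<Rightarrow> nat \<Rightarrow> nat" where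
  "stepped Zero t x = 1"
| "stepped Succ t x = Suc (Suc x)"
| "stepped Fst t x = Suc (pfst x)"
| "stepped Snd t x = Suc (psnd x)"
| "stepped (Fork f g) t x =
     case_nat 0 (\<lambda>a. case_nat 0 (\<lambda>b. Suc (prod_encode (a, b))) (stepped g t x)) (stepped f t x)"
| "stepped (Comp f g) t x = case_nat 0 (\<lambda>b. stepped f t b) (stepped g t x)"
| "stepped (Prec f g) t x =
     rec_nat (stepped f t (pfst x))
       (\<lambda>k r. case_nat 0 (\<lambda>v. stepped g t (prod_encode (pfst x, prod_encode (k, v)))) r) (psnd x)"
| "stepped (Mn f) t x = search (\<lambda>k. stepped f t (prod_encode (x, k))) t - 1"

text \<open>\<open>t\<close> and \<open>x\<close> are functions of an arbitrary environment, since
  recursion and case distinction extend the environment by pairing.\<close>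

lemma computable_stepped:
  assumes "computable_fun t" "computable_fun x"
  shows "computable_fun (\<lambda>z. stepped A (t z) (x z))"
  using assms
proof (induction A arbitrary: t x)
  case (Mn f)
  show ?case unfolding stepped.simps
    by (intro computable_fun_diff computable_intros Mn.IH Mn.prems
          computable_fun_comp[of t] computable_fun_comp[of x])
next
  case (Prec f g)
  show ?case unfolding stepped.simps
    by (intro computable_intros Prec.IH Prec.prems
          computable_fun_comp[of t] computable_fun_comp[of x])
next
  case (Fork f g)
  show ?case unfolding stepped.simps
    by (intro computable_intros Fork.IH Fork.prems
          computable_fun_comp[of t] computable_fun_comp[of x])
next
  case (Comp f g)
  show ?case unfolding stepped.simps
    by (intro computable_intros Comp.IH Comp.prems
          computable_fun_comp[of t] computable_fun_comp[of x])
qed (auto intro!: computable_intros)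

lemma search_state:
  "(search h t = 0 \<longleftrightarrow> (\<forall>k<t. 2 \<le> h k)) \<and>
   (\<forall>n. search h t = Suc (Suc n) \<longleftrightarrow> n < t \<and> h n = 1 \<and> (\<forall>k<n. 2 \<le> h k))"
proof (induction t)
  case (Suc t)
  define s where "s = search h t"
  have IH0: "s = 0 \<longleftrightarrow> (\<forall>k<t. 2 \<le> h k)"
    and IH2: "\<And>n. s = Suc (Suc n) \<longleftrightarrow> n < t \<and> h n = 1 \<and> (\<forall>k<n. 2 \<le> h k)"
    using Suc unfolding s_def by blast+
  have step: "search h (Suc t) =
      case_nat (case_nat 1 (case_nat (Suc (Suc t)) (\<lambda>_. 0)) (h t)) Suc s"
    by (simp add: s_def)
  show ?case
  proof (cases s)
    case 0
    then have ge: "\<forall>k<t. 2 \<le> h k" using IH0 by simp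
    have not1: "n < Suc t \<and> h n = 1 \<longleftrightarrow> n = t \<and> h t = 1" for n
      using ge less_Suc_eq by fastforce
    consider "h t = 0" | "h t = 1" | "2 \<le> h t" by linarith
    then show ?thesis
      using 0 ge not1 unfolding step by cases (auto simp: less_Suc_eq split: nat.splits)
  next
    case (Suc m)
    have "\<not> (\<forall>k<Suc t. 2 \<le> h k)" using Suc IH0 by (metis less_SucI nat.distinct(1))
    moreover have "\<not> (\<forall>k<t. 2 \<le> h k)" using Suc IH0 by simp
    then have "s = Suc (Suc n) \<longleftrightarrow> n < Suc t \<and> h n = 1 \<and> (\<forall>k<n. 2 \<le> h k)" for n
      using IH2[of n] less_Suc_eq by metis
    ultimately show ?thesis using Suc unfolding step by simp
  qed
qed simp

text \<open>Truncated subtraction merges the states 0 (searching) and 1 (stuck) into 0, the sign of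
  a missing result.\<close>

lemma search_found:
  "search h t - 1 = Suc n \<longleftrightarrow> n < t \<and> h n = 1 \<and> (\<forall>k<n. 2 \<le> h k)"
  using search_state[of h t] by (cases "search h t") auto

text \<open>This lets finitely many evaluations share one bound.\<close>

lemma stepped_mono:
  "stepped A t x = Suc v \<Longrightarrow> t \<le> t' \<Longrightarrow> stepped A t' x = Suc v"
proof (induction A arbitrary: x v)
  case (Fork f g)
  then show ?case by (auto split: nat.splits)
next
  case (Comp f g)
  then show ?case by (auto split: nat.splits)
next
  case (Prec f g)
  let ?R = "\<lambda>t. rec_nat (stepped f t (pfst x))
       (\<lambda>k r. case_nat 0 (\<lambda>v. stepped g t (prod_encode (pfst x, prod_encode (k, v)))) r)"
  have "?R t n = Suc v \<Longrightarrow> ?R t' n = Suc v" for n v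
  proof (induction n arbitrary: v)
    case 0
    then show ?case using Prec by simp
  next
    case (Suc n)
    then show ?case using Prec by (auto split: nat.splits)
  qed
  then show ?case using Prec.prems by simp
next
  case (Mn f)
  then have n: "v < t" "stepped f t (prod_encode (x, v)) = 1"
    "\<forall>k<v. 2 \<le> stepped f t (prod_encode (x, k))"
    unfolding stepped.simps search_found by blast+
  have "2 \<le> stepped f t' (prod_encode (x, k))" if "k < v" for k
    using n(3) that Mn.IH[of "prod_encode (x, k)" "stepped f t (prod_encode (x, k)) - 1"] \<open>t \<le> t'\<close>
    by fastforce
  moreover have "stepped f t' (prod_encode (x, v)) = 1"
    using n(2) Mn.IH \<open>t \<le> t'\<close> by simp
  ultimately show ?case
    using n(1) \<open>t \<le> t'\<close> by (simp only: stepped.simps search_found) simp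
qed auto

lemma stepped_sound: "stepped A t x = Suc v \<Longrightarrow> run A x = Some v"
proof (induction A arbitrary: x v)
  case (Fork f g)
  then show ?case by (auto split: nat.splits)
next
  case (Comp f g)
  then show ?case by (auto split: nat.splits)
next
  case (Prec f g)
  let ?R = "rec_nat (stepped f t (pfst x))
       (\<lambda>k r. case_nat 0 (\<lambda>v. stepped g t (prod_encode (pfst x, prod_encode (k, v)))) r)"
  let ?S = "rec_nat (run f (pfst x))
       (\<lambda>k r. Option.bind r (\<lambda>v. run g (prod_encode (pfst x, prod_encode (k, v)))))"
  have "?R n = Suc v \<Longrightarrow> ?S n = Some v" for n v
  proof (induction n arbitrary: v)
    case 0
    then show ?case using Prec by simp
  next
    case (Suc n)
    then show ?case using Prec by (auto split: nat.splits)
  qed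
  then show ?case using Prec.prems by (simp add: case_prod_beta)
next
  case (Mn f)
  then have n: "stepped f t (prod_encode (x, v)) = 1"
    "\<forall>k<v. 2 \<le> stepped f t (prod_encode (x, k))"
    unfolding stepped.simps search_found by blast+
  have r: "run f (prod_encode (x, v)) = Some 0" using n(1) Mn.IH by simp
  have l: "\<exists>w. run f (prod_encode (x, k)) = Some (Suc w)" if "k < v" for k
  proof -
    have "stepped f t (prod_encode (x, k)) = Suc (Suc (stepped f t (prod_encode (x, k)) - 2))"
      using n(2) that by fastforce
    then show ?thesis using Mn.IH by blast
  qed
  have "(LEAST n. run f (prod_encode (x, n)) = Some 0) = v"
  proof (rule Least_equality)
    show "run f (prod_encode (x, v)) = Some 0" by (rule r)
    show "v \<le> k" if "run f (prod_encode (x, k)) = Some 0" for k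
      using that l[of k] by (cases "k < v") auto
  qed
  moreover have "\<exists>n. run f (prod_encode (x, n)) = Some 0 \<and>
      (\<forall>k<n. run f (prod_encode (x, k)) \<noteq> None)"
    using r l by fastforce
  ultimately show ?case by simp
qed auto

lemma stepped_complete: "run A x = Some v \<Longrightarrow> \<exists>t. stepped A t x = Suc v"
proof (induction A arbitrary: x v)
  case (Fork f g)
  then obtain a b where ab: "run f x = Some a" "run g x = Some b" "v = prod_encode (a, b)"
    by (auto simp: bind_eq_Some_conv)
  obtain t u where "stepped f t x = Suc a" "stepped g u x = Suc b"
    using ab Fork.IH by blast
  then have "stepped f (max t u) x = Suc a" "stepped g (max t u) x = Suc b"
    using stepped_mono max.cobounded1 max.cobounded2 by blast+
  then show ?case using ab by (intro exI[of _ "max t u"]) simp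
next
  case (Comp f g)
  then obtain b where b: "run g x = Some b" "run f b = Some v"
    by (auto simp: bind_eq_Some_conv)
  obtain t u where "stepped f t b = Suc v" "stepped g u x = Suc b"
    using b Comp.IH by blast
  then have "stepped f (max t u) b = Suc v" "stepped g (max t u) x = Suc b"
    using stepped_mono max.cobounded1 max.cobounded2 by blast+
  then show ?case by (intro exI[of _ "max t u"]) simp
next
  case (Prec f g)
  let ?R = "\<lambda>t. rec_nat (stepped f t (pfst x))
       (\<lambda>k r. case_nat 0 (\<lambda>v. stepped g t (prod_encode (pfst x, prod_encode (k, v)))) r)"
  let ?S = "rec_nat (run f (pfst x))
       (\<lambda>k r. Option.bind r (\<lambda>v. run g (prod_encode (pfst x, prod_encode (k, v)))))"
  \<comment> \<open>Partial recursions are themselves runs of \<open>Prec f g\<close>, so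
    \<open>stepped_mono\<close> applies to them.\<close>
  have R: "?R t n = stepped (Prec f g) t (prod_encode (pfst x, n))" for t n
    unfolding stepped.simps prod_encode_inverse fst_conv snd_conv ..
  have "?S n = Some v \<Longrightarrow> \<exists>t. ?R t n = Suc v" for n v
  proof (induction n arbitrary: v)
    case 0
    then show ?case using Prec.IH(1) by simp
  next
    case (Suc n)
    then obtain w where w: "?S n = Some w"
      "run g (prod_encode (pfst x, prod_encode (n, w))) = Some v"
      by (auto simp: bind_eq_Some_conv)
    obtain t u where "?R t n = Suc w" "stepped g u (prod_encode (pfst x, prod_encode (n, w))) = Suc v"
      using w Suc.IH Prec.IH(2) by blast
    then have "?R (max t u) n = Suc w"
      "stepped g (max t u) (prod_encode (pfst x, prod_encode (n, w))) = Suc v"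
      using stepped_mono max.cobounded1 max.cobounded2 unfolding R by blast+
    then show ?case by (intro exI[of _ "max t u"]) simp
  qed
  then show ?case using Prec.prems by (simp add: case_prod_beta)
next
  case (Mn f)
  let ?f = "\<lambda>k. run f (prod_encode (x, k))"
  from Mn.prems obtain n where n: "?f n = Some 0" "\<forall>k<n. ?f k \<noteq> None"
    and v: "v = (LEAST n. ?f n = Some 0)"
    by (auto split: if_splits)
  have r: "?f v = Some 0" unfolding v using n(1) by (rule LeastI[of "\<lambda>n. ?f n = Some 0"])
  have "v \<le> n" unfolding v using n(1) by (rule Least_le[of "\<lambda>n. ?f n = Some 0"])
  have l: "\<exists>w. ?f k = Some (Suc w)" if "k < v" for k
    using that n(2) \<open>v \<le> n\<close> not_less_Least[of k "\<lambda>n. ?f n = Some 0"] v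
    by (metis less_le_trans not0_implies_Suc option.exhaust)
  have "\<forall>k\<in>{..v}. \<exists>t. stepped f t (prod_encode (x, k)) = Suc (the (?f k))"
    using Mn.IH l r by (metis atMost_iff le_eq_less_or_eq option.sel)
  then obtain t where t: "\<forall>k\<in>{..v}. stepped f (t k) (prod_encode (x, k)) = Suc (the (?f k))"
    by metis
  \<comment> \<open>The sum dominates every \<open>t k\<close>; \<open>Suc v\<close> is added
    because the search itself must reach round \<open>v\<close>.\<close>
  define T where "T = Suc (v + (\<Sum>k\<le>v. t k))"
  have "t k \<le> T" if "k \<le> v" for k
    using member_le_sum[of k "{..v}" t] that by (simp add: T_def)
  then have T: "stepped f T (prod_encode (x, k)) = Suc (the (?f k))" if "k \<le> v" for k
    using t stepped_mono that by (metis atMost_iff)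
  have "2 \<le> stepped f T (prod_encode (x, k))" if "k < v" for k
    using T[of k] l[OF that] that by auto
  moreover have "stepped f T (prod_encode (x, v)) = 1"
    using T[of v] r by simp
  ultimately have "stepped (Mn f) T x = Suc v"
    by (simp only: stepped.simps search_found) (simp add: T_def)
  then show ?case by blast
qed auto

section \<open>Self-referential programs\<close>

text \<open>
  The numbers of \<open>h\<close> and \<open>q\<close>, which are handed to \<open>h\<close>, suffice to compute the number of the whole
  program. Only \<open>q\<close> may diverge, so \<open>q\<close> is run, at \<open>probe\<close>, outside of \<open>h\<close>.
\<close>

definition probe :: nat where "probe = prod_encode (int_encode (-1), 2)"

definition quine :: "prog \<Rightarrow> prog \<Rightarrow> prog" where
  "quine h q =
     Comp h (Fork (Comp q (const_prog probe))
       (Fork (const_prog (prod_encode (encode_prog h, encode_prog q))) id_prog))"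

definition const_code :: "nat \<Rightarrow> nat" where
  "const_code = rec_nat (prod_encode (0, 0))
     (\<lambda>_ c. prod_encode (5, prod_encode (prod_encode (1, 0), c)))"

definition quine_code :: "nat \<Rightarrow> nat" where
  "quine_code e =
     prod_encode (5, prod_encode (pfst e,
       prod_encode (4, prod_encode (
         prod_encode (5, prod_encode (psnd e, const_code probe)),
         prod_encode (4, prod_encode (const_code e, encode_prog id_prog))))))"

lemma run_quine:
  "run q probe = Some y \<Longrightarrow> run (quine h q) x =
     run h (prod_encode (y, prod_encode (prod_encode (encode_prog h, encode_prog q), x)))"
  by (simp add: quine_def)

lemma encode_const_prog: "encode_prog (const_prog n) = const_code n"
  by (induction n) (simp_all add: const_code_def)

text \<open>The pair of numbers serves twice: its components are the parts of the program, and the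
  pair itself is the constant embedded in it.\<close>

lemma encode_quine:
  "encode_prog (quine h q) = quine_code (prod_encode (encode_prog h, encode_prog q))"
  by (simp add: quine_def quine_code_def encode_const_prog)

lemma computable_quine_code:
  assumes "computable_fun f"
  shows "computable_fun (\<lambda>x. quine_code (f x))"
  unfolding quine_code_def const_code_def
  by (intro computable_intros assms)

section \<open>Binary digits and codes of rationals\<close>

lemma int_encode_of_nat: "int_encode (int n) = 2 * n"
  by (simp add: int_encode_def sum_encode_def)

lemma odd_int_encode_neg: "n < 0 \<Longrightarrow> odd (int_encode n)"
  by (simp add: int_encode_def sum_encode_def)

lemma of_rat_decode_rat:
  "real_of_rat (decode_rat y) = of_int (int_decode (pfst y)) / real (Suc (psnd y))"
  by (simp add: decode_rat_def case_prod_beta of_rat_divide del: of_nat_Suc)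

lemma of_rat_decode_rat_even:
  "real_of_rat (decode_rat (prod_encode (2 * a, b))) = real a / real (Suc b)"
proof -
  have "int_decode (2 * a) = int a"
    using int_encode_inverse[of "int a"] by (simp add: int_encode_of_nat)
  then show ?thesis by (simp add: of_rat_decode_rat)
qed

text \<open>From 3/4 <= a/(b+1) the numerator a is nonnegative, so its code is 2a >= 3/2 (b+1) > b.
  Comparing raw codes spares \<open>gate\<close> rational arithmetic.\<close>

lemma decode_rat_near_1:
  assumes "\<bar>real_of_rat (decode_rat y) - 1\<bar> \<le> 1 / 4"
  shows "psnd y < pfst y"
proof -
  let ?a = "int_decode (pfst y)" and ?b = "real (Suc (psnd y))"
  have "3 / 4 \<le> of_int ?a / ?b" using assms unfolding of_rat_decode_rat by linarith
  then have le: "3 / 4 * ?b \<le> of_int ?a" by (simp add: pos_le_divide_eq)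
  then have "0 \<le> ?a" by simp
  then have "pfst y = 2 * nat ?a"
    using int_decode_inverse[of "pfst y"] int_encode_of_nat[of "nat ?a"] by simp
  with le \<open>0 \<le> ?a\<close> show ?thesis by simp
qed

text \<open>The code of a numerator a is at most 2|a|, while 4|a| <= b+1.\<close>

lemma decode_rat_near_0:
  assumes "\<bar>real_of_rat (decode_rat y)\<bar> \<le> 1 / 4"
  shows "pfst y \<le> psnd y"
proof -
  let ?a = "int_decode (pfst y)" and ?b = "real (Suc (psnd y))"
  have "\<bar>of_int ?a\<bar> / ?b \<le> 1 / 4" using assms unfolding of_rat_decode_rat by simp
  then have "\<bar>of_int ?a\<bar> \<le> ?b / 4" by (simp add: field_simps)
  then have "real_of_int (4 * \<bar>?a\<bar>) \<le> real_of_int (int (Suc (psnd y)))" by simp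
  then have "4 * \<bar>?a\<bar> \<le> int (Suc (psnd y))" by (simp only: of_int_le_iff)
  moreover have "int (pfst y) \<le> 2 * \<bar>?a\<bar>"
    using int_decode_inverse[of "pfst y"]
    by (auto simp: int_encode_def sum_encode_def split: if_splits)
  ultimately show ?thesis by linarith
qed

lemma summable_binary:
  fixes d :: "nat \<Rightarrow> nat"
  assumes "\<And>k. d k \<in> {0, 1}"
  shows "summable (\<lambda>k. real (d k) / 2 ^ Suc k)"
proof (rule summable_comparison_test')
  show "summable (\<lambda>k. (1 / 2) ^ Suc k :: real)" by (simp add: summable_geometric)
  show "norm (real (d k) / 2 ^ Suc k) \<le> (1 / 2) ^ Suc k" if "0 \<le> k" for k
    using assms[of k] by (auto simp: field_simps)
qed

text \<open>The tail is dominated by a geometric series with sum \<open>1 / 2 ^ k\<close>.\<close>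

lemma binary_truncation:
  fixes d :: "nat \<Rightarrow> nat"
  assumes d: "\<And>k. d k \<in> {0, 1}"
  shows "\<bar>(\<Sum>j<k. real (d j) / 2 ^ Suc j) - (\<Sum>j. real (d j) / 2 ^ Suc j)\<bar> \<le> 1 / 2 ^ k"
proof -
  let ?f = "\<lambda>j. real (d j) / 2 ^ Suc j"
  have s: "summable (\<lambda>j. ?f (j + k))"
    using summable_binary[of d, OF d] by (rule summable_ignore_initial_segment)
  have geo: "(\<lambda>j. 1 / 2 ^ k * (1 / 2) ^ Suc j :: real) sums (1 / 2 ^ k * 1)"
    by (intro sums_mult power_half_series)
  have "(\<Sum>j. ?f (j + k)) \<le> (\<Sum>j. 1 / 2 ^ k * (1 / 2) ^ Suc j)"
  proof (rule suminf_le[OF _ s sums_summable[OF geo]])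
    show "?f (j + k) \<le> 1 / 2 ^ k * (1 / 2) ^ Suc j" for j
      using d[of "j + k"] by (auto simp: field_simps power_add)
  qed
  moreover have "0 \<le> (\<Sum>j. ?f (j + k))" by (rule suminf_nonneg[OF s]) simp
  ultimately show ?thesis
    using suminf_split_initial_segment[OF summable_binary[of d, OF d], of k] sums_unique[OF geo]
    by simp
qed

lemma binary_in_computable_reals:
  assumes "\<And>k. d k \<in> {0, 1}" "computable_fun d"
  shows "(\<Sum>k. real (d k) / 2 ^ Suc k) \<in> computable_reals"
  unfolding computable_reals_def
  using assms by (intro CollectI exI[of _ "1::real"] exI[of _ "0::nat"] exI[of _ d]) simp

lemma of_nat_in_computable_reals: "real m \<in> computable_reals"
  unfolding computable_reals_def
  by (intro CollectI exI[of _ "1::real"] exI[of _ m] exI[of _ "\<lambda>_. 0"])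
    (simp add: computable_fun_const)

lemma computable_fun_if_less:
  assumes "computable_fun f" "computable_fun g" "computable_fun a" "computable_fun b"
  shows "computable_fun (\<lambda>x. if f x < g x then a x else b x)"
proof -
  have "(if f x < g x then a x else b x) = case_nat (b x) (\<lambda>_. a x) (g x - f x)" for x
    by (auto split: nat.splits)
  moreover have "computable_fun (\<lambda>z. a (pfst z))"
    by (rule computable_fun_comp[OF assms(3)]) (intro computable_intros)
  then have "computable_fun (\<lambda>x. case_nat (b x) (\<lambda>_. a x) (g x - f x))"
    using assms by (intro computable_intros computable_fun_diff)
  ultimately show ?thesis by simp
qed

lemmas computable_arith_intros = computable_intros computable_fun_add computable_fun_diff
  computable_fun_parity computable_fun_if_less computable_stepped computable_quine_code

section \<open>Halting of the inversion algorithm decides a coefficient\<close>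

text \<open>
  Coefficient with integer code \<open>m\<close> of the series \<open>r\<close> with number \<^term>\<open>quine_code e\<close>. If \<open>y\<close> codes a
  rational near \<open>1\<close>, then \<open>r = 1\<close>. If it codes a rational near \<open>0\<close>, then \<open>r\<close> vanishes up to any
  bound that \<open>A\<close> attaches to the inverse of \<open>r\<close>, which keeps a correct \<open>A\<close> from halting on \<open>r\<close>.
\<close>

definition gate :: "prog \<Rightarrow> nat \<Rightarrow> nat \<Rightarrow> nat \<Rightarrow> nat" where
  "gate A y e m =
     (if psnd y < pfst y then (if m < 1 then 1 else 0)
      else if m mod 2 < 1 then
        case_nat 0 (\<lambda>v. if psnd v + psnd v < m then 1 else 0)
          (stepped A m (prod_encode (quine_code e, 0)))
      else 0)"

text \<open>Doubling turns a natural number into the code of a nonnegative numerator, and 0 codes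
  the denominator 1.\<close>

lemma computable_gate:
  "computable_fun (\<lambda>w. prod_encode (gate A (pfst w) (pfst (psnd w)) (pfst (psnd (psnd w))) +
     gate A (pfst w) (pfst (psnd w)) (pfst (psnd (psnd w))), 0))"
  unfolding gate_def by (intro computable_arith_intros)

lemma halts_on_gate_iff:
  assumes A: "computes_inverses A"
    and q: "represents q N z" and z: "fls_nth z (-1) \<in> {0, 1}"
    and h: "\<And>y e m k. run h (prod_encode (y, prod_encode (e, prod_encode (m, k)))) =
              Some (prod_encode (2 * gate A y e m, 0))"
  shows "run A (encode_rep (quine h q) 0) \<noteq> None \<longleftrightarrow> fls_nth z (-1) = 1"
proof -
  let ?r = "quine h q"
  \<comment> \<open>\<open>probe\<close> asks for index -1 with error at most 1/4, which separates 0
    from 1.\<close>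
  obtain y where y: "run q probe = Some y"
    and near: "\<bar>real_of_rat (decode_rat y) - fls_nth z (-1)\<bar> \<le> 1 / 4"
    using q unfolding represents_def probe_def
    by (metis (no_types, lifting) four_x_squared mult_2 numeral_Bit0 one_power2 power2_eq_square)
  define e where "e = prod_encode (encode_prog h, encode_prog q)"
  have code: "prod_encode (quine_code e, 0) = encode_rep ?r 0"
    by (simp add: e_def encode_quine encode_rep_def)
  define c where "c = gate A y e"
  have run_r: "run ?r (prod_encode (m, k)) = Some (prod_encode (2 * c m, 0))" for m k
    by (simp add: run_quine[OF y] h c_def e_def)
  have c01: "c m \<in> {0, 1}" for m
    by (auto simp: c_def gate_def split: nat.splits)
  have odd: "c m = 0" if "odd m" for m
    using that by (auto simp: c_def gate_def odd_iff_mod_2_eq_one)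
  \<comment> \<open>Index \<open>i\<close> has code \<open>2 * i\<close>; negative indices have odd
    codes, where \<open>c\<close> vanishes, so a power series suffices.\<close>
  define x where "x = fps_to_fls (Abs_fps (\<lambda>i. real (c (2 * i))))"
  have x_nth: "fls_nth x n = real (c (int_encode n))" for n
  proof (cases "n < 0")
    case True
    then show ?thesis using odd[OF odd_int_encode_neg] by (simp add: x_def)
  next
    case False
    then show ?thesis using int_encode_of_nat[of "nat n"] by (simp add: x_def)
  qed
  have rep: "represents ?r 0 x"
    unfolding represents_def run_r
  proof (intro conjI allI impI)
    show "fls_nth x n = 0" if "n < - int 0" for n using that by (simp add: x_def)
    show "\<exists>y. Some (prod_encode (2 * c (int_encode n), 0)) = Some y \<and>
           \<bar>real_of_rat (decode_rat y) - fls_nth x n\<bar> \<le> 1 / 2 ^ k" for n k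
      by (simp add: of_rat_decode_rat_even x_nth)
  qed
  then have "x \<in> computable_series"
    unfolding computable_series_def using of_nat_in_computable_reals x_nth by auto
  then have halts: "\<exists>q M. run A (encode_rep ?r 0) = Some (encode_rep q M) \<and>
      represents q M (inverse x)" if "x \<noteq> 0"
    using A rep that unfolding computes_inverses_def by blast
  consider "fls_nth z (-1) = 1" | "fls_nth z (-1) = 0" using z by blast
  then show ?thesis
  proof cases
    case 1
    then have "psnd y < pfst y" using near by (intro decode_rat_near_1) simp
    then have "c 0 = 1" by (simp add: c_def gate_def)
    then have "fls_nth x 0 \<noteq> 0" using x_nth[of 0] int_encode_of_nat[of 0] by simp
    then have "x \<noteq> 0" by auto
    then show ?thesis using 1 halts by auto
  next
    case 2
    then have "\<not> psnd y < pfst y" using near decode_rat_near_0[of y] by simp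
    then have c: "c m = (if even m then case_nat 0 (\<lambda>v. if psnd v + psnd v < m then 1 else 0)
                  (stepped A m (encode_rep ?r 0)) else 0)" for m
      by (simp add: c_def gate_def code even_iff_mod_2_eq_zero)
    have "run A (encode_rep ?r 0) = None"
    proof (rule ccontr)
      assume "run A (encode_rep ?r 0) \<noteq> None"
      then obtain v where v: "run A (encode_rep ?r 0) = Some v" by blast
      then obtain t where t: "stepped A t (encode_rep ?r 0) = Suc v"
        using stepped_complete by blast
      \<comment> \<open>Index \<open>i\<close> lies beyond the bound in \<open>v\<close>, and its
        code \<open>2 * i\<close> allows enough steps to see \<open>A\<close> halt.\<close>
      define i where "i = Suc (t + psnd v)"
      have "stepped A (2 * i) (encode_rep ?r 0) = Suc v"
        by (rule stepped_mono[OF t]) (simp add: i_def)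
      then have "c (2 * i) = 1" by (simp add: c i_def)
      then have "fls_nth x (int i) \<noteq> 0" by (simp add: x_nth int_encode_of_nat)
      then have "x \<noteq> 0" by auto
      then obtain q' M where M: "v = encode_rep q' M" "represents q' M (inverse x)"
        using halts v by auto
      have "int M < n" if "fls_nth x n \<noteq> 0" for n
      proof -
        have "0 \<le> n" using that unfolding x_def by (rule contrapos_np) simp
        have "c (int_encode n) \<noteq> 0" using that x_nth by simp
        then obtain w where w: "stepped A (int_encode n) (encode_rep ?r 0) = Suc w"
          and lt: "psnd w + psnd w < int_encode n"
          by (auto simp: c split: if_splits nat.splits)
        \<comment> \<open>All sufficient step bounds yield the same output, so the guard in
          \<open>gate\<close> always compares the index with \<open>M\<close>.\<close>
        have "w = v" using stepped_sound[OF w] v by simp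
        then show ?thesis
          using lt M(1) \<open>0 \<le> n\<close> int_encode_of_nat[of "nat n"] by (simp add: encode_rep_def)
      qed
      \<comment> \<open>The inverse starts at the negated subdegree, hence below \<open>- M\<close>,
        against the bound that \<open>A\<close> attached.\<close>
      then have "int M < fls_subdegree x" using \<open>x \<noteq> 0\<close> by simp
      then have "fls_nth (inverse x) (- fls_subdegree x) = 0"
        using M(2) unfolding represents_def by simp
      moreover have "fls_nth (inverse x) (- fls_subdegree x) \<noteq> 0"
        using nth_fls_subdegree_nonzero[of "inverse x"] \<open>x \<noteq> 0\<close> by simp
      ultimately show False by simp
    qed
    then show ?thesis using 2 by simp
  qed
qed

section \<open>The diagonal series\<close>

text \<open>For nonzero \<open>a\<close> the subdegree is 0, so the inverse has no negative part;
  for \<open>a = 0\<close> the inverse is the monomial of degree -1.\<close>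

lemma inverse_const_plus_X_nth:
  fixes a :: real
  shows "fls_nth (inverse (fls_const a + fls_X)) (-1) = (if a = 0 then 1 else 0)"
proof (cases "a = 0")
  case True
  then show ?thesis by (simp add: fls_inverse_X)
next
  case False
  then have "fls_subdegree (fls_const a + fls_X) = 0"
    by (intro fls_subdegree_eqI) simp_all
  then have "fls_subdegree (inverse (fls_const a + fls_X)) = 0" by simp
  then show ?thesis using False by simp
qed

text \<open>
  The digit \<open>k\<close> is set if within \<open>k\<close> steps \<open>A\<close> halts on the series with number \<^term>\<open>quine_code e\<close>,
  outputting a program \<open>q\<close>, and then halts on the gate for \<open>q\<close>. Here \<open>h\<close> is the number of the
  program computing \<^const>\<open>gate\<close>.
\<close>

definition digit :: "prog \<Rightarrow> nat \<Rightarrow> nat \<Rightarrow> nat \<Rightarrow> nat" where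
  "digit A h e k =
     case_nat 0
       (\<lambda>v. case_nat 0 (\<lambda>_. 1)
         (stepped A k (prod_encode (quine_code (prod_encode (h, pfst v)), 0))))
       (stepped A k (prod_encode (quine_code e, 0)))"

text \<open>The values 0, 1, 2 of \<open>m\<close> code the indices 0, -1, 1. At index 0 the first
  \<open>k\<close> digits are put over \<open>2 ^ k\<close>, with the numerator doubled and the
  denominator lowered by one to fit \<open>decode_rat\<close>.\<close>

definition diag :: "prog \<Rightarrow> nat \<Rightarrow> nat \<Rightarrow> nat \<Rightarrow> nat \<Rightarrow> nat" where
  "diag A h e m k =
     (if m < 1 then
        prod_encode (rec_nat 0 (\<lambda>j s. (s + s) + (digit A h e j + digit A h e j)) k,
          rec_nat 0 (\<lambda>_ s. Suc (s + s)) k)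
      else if m < 2 then prod_encode (0, 0)
      else if m < 3 then prod_encode (2, 0)
      else prod_encode (0, 0))"

lemma computable_digit: "computable_fun (digit A h e)"
  unfolding digit_def by (intro computable_arith_intros)

lemma computable_diag:
  "computable_fun (\<lambda>w. diag A h (pfst (psnd w)) (pfst (psnd (psnd w))) (psnd (psnd (psnd w))))"
  unfolding diag_def digit_def by (intro computable_arith_intros)

lemma digit_01: "digit A h e k \<in> {0, 1}"
  by (auto simp: digit_def split: nat.splits)

lemma decode_diag_0:
  "real_of_rat (decode_rat (diag A h e 0 k)) = (\<Sum>j<k. real (digit A h e j) / 2 ^ Suc j)"
proof -
  define S where "S = rec_nat 0 (\<lambda>j s. s + s + digit A h e j)"
  have num: "rec_nat 0 (\<lambda>j s. (s + s) + (digit A h e j + digit A h e j)) k = 2 * S k" for k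
    by (induction k) (simp_all add: S_def)
  have den: "Suc (rec_nat 0 (\<lambda>_ s. Suc (s + s)) k) = 2 ^ k" for k
    by (induction k) simp_all
  have "real (S k) / 2 ^ k = (\<Sum>j<k. real (digit A h e j) / 2 ^ Suc j)" for k
    by (induction k) (simp_all add: S_def add_divide_distrib flip: mult_2)
  then show ?thesis by (simp add: diag_def num of_rat_decode_rat_even den del: of_nat_Suc)
qed

lemma decode_diag_pos:
  assumes "n \<noteq> 0"
  shows "real_of_rat (decode_rat (diag A h e (int_encode n) k)) = (if n = 1 then 1 else 0)"
proof -
  have "int_encode n \<noteq> 0" "int_encode n = 2 \<longleftrightarrow> n = 1"
    using assms int_encode_eq[of n 0] int_encode_eq[of n 1] int_encode_of_nat[of 0]
      int_encode_of_nat[of 1] by simp_all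
  then show ?thesis
    using of_rat_decode_rat_even[of 0 0] of_rat_decode_rat_even[of 1 0]
    by (auto simp: diag_def)
qed

theorem theorem9p2:
  shows "\<not> (\<exists>A. computes_inverses A)"
proof
  assume "\<exists>A. computes_inverses A"
  then obtain A where A: "computes_inverses A" by blast
  obtain h where h: "\<And>w. run h w = Some (prod_encode
      (gate A (pfst w) (pfst (psnd w)) (pfst (psnd (psnd w))) +
       gate A (pfst w) (pfst (psnd w)) (pfst (psnd (psnd w))), 0))"
    using computable_gate unfolding computable_fun_def by blast
  let ?h = "encode_prog h"
  obtain g where g: "\<And>w. run g w = Some (diag A ?h (pfst (psnd w))
      (pfst (psnd (psnd w))) (psnd (psnd (psnd w))))"
    using computable_diag unfolding computable_fun_def by blast
  \<comment> \<open>\<open>Zero\<close> halts everywhere, so this program is total, as a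
    representation must be.\<close>
  let ?p = "quine g Zero"
  define e where "e = prod_encode (encode_prog g, encode_prog Zero)"
  define d where "d = digit A ?h e"
  define a where "a = (\<Sum>k. real (d k) / 2 ^ Suc k)"
  define x where "x = fls_const a + fls_X"
  have d01: "d k \<in> {0, 1}" for k using digit_01 by (simp add: d_def)
  have run_p: "run ?p (prod_encode (m, k)) = Some (diag A ?h e m k)" for m k
    using run_quine[of Zero 0] by (simp add: g e_def)
  have x_nth: "fls_nth x n = (if n = 0 then a else if n = 1 then 1 else 0)" for n
    by (simp add: x_def)
  have rep: "represents ?p 0 x"
    unfolding represents_def run_p
  proof (intro conjI allI impI)
    show "fls_nth x n = 0" if "n < - int 0" for n using that by (simp add: x_nth)
    fix n k
    show "\<exists>y. Some (diag A ?h e (int_encode n) k) = Some y \<and>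
           \<bar>real_of_rat (decode_rat y) - fls_nth x n\<bar> \<le> 1 / 2 ^ k"
    proof (cases "n = 0")
      case True
      then show ?thesis
        using binary_truncation[of d k, OF d01] int_encode_of_nat[of 0]
        by (simp add: x_nth decode_diag_0 a_def d_def)
    next
      case False
      then show ?thesis by (simp add: x_nth decode_diag_pos)
    qed
  qed
  \<comment> \<open>Each digit depends on bounded runs only, although \<open>a = 0\<close> is a
    statement about unbounded halting.\<close>
  have "a \<in> computable_reals"
    unfolding a_def using d01 computable_digit by (intro binary_in_computable_reals) (simp_all add: d_def)
  then have "x \<in> computable_series"
    unfolding computable_series_def
    using rep x_nth of_nat_in_computable_reals[of 0] of_nat_in_computable_reals[of 1] by auto
  moreover have "x \<noteq> 0" using x_nth[of 1] by auto
  ultimately obtain q M where q: "run A (encode_rep ?p 0) = Some (encode_rep q M)"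
    and inv: "represents q M (inverse x)"
    using A rep unfolding computes_inverses_def by blast
  have coeff: "fls_nth (inverse x) (-1) = (if a = 0 then 1 else 0)"
    unfolding x_def by (rule inverse_const_plus_X_nth)
  have gate: "run A (encode_rep (quine h q) 0) \<noteq> None \<longleftrightarrow> a = 0"
    using halts_on_gate_iff[OF A inv, of h] coeff h by (simp add: mult_2)
  have d: "d k = case_nat 0 (\<lambda>v. case_nat 0 (\<lambda>_. 1)
      (stepped A k (prod_encode (quine_code (prod_encode (?h, pfst v)), 0))))
      (stepped A k (encode_rep ?p 0))" for k
    by (simp add: d_def digit_def e_def encode_rep_def encode_quine)
  \<comment> \<open>The program number in the output of \<open>A\<close> is that of
    \<open>q\<close>, so the second run in \<open>digit\<close> is on the gate for
    \<open>q\<close>.\<close>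
  have hq: "prod_encode (quine_code (prod_encode (?h, pfst (encode_rep q M))), 0) =
      encode_rep (quine h q) 0"
    by (simp add: encode_rep_def encode_quine)
  \<comment> \<open>Read off the digits, the same halting means that \<open>a\<close> is nonzero,
    contradicting \<open>gate\<close>.\<close>
  have "run A (encode_rep (quine h q) 0) \<noteq> None \<longleftrightarrow> (\<exists>k. d k = 1)"
  proof
    assume "run A (encode_rep (quine h q) 0) \<noteq> None"
    then obtain v t where t: "stepped A t (encode_rep (quine h q) 0) = Suc v"
      using stepped_complete by blast
    obtain u where u: "stepped A u (encode_rep ?p 0) = Suc (encode_rep q M)"
      using q stepped_complete by blast
    \<comment> \<open>A digit imposes one bound on both runs, hence the maximum.\<close>
    have "d (max t u) = 1"
      using stepped_mono[OF t, of "max t u"] stepped_mono[OF u, of "max t u"]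
      by (simp add: d hq)
    then show "\<exists>k. d k = 1" ..
  next
    assume "\<exists>k. d k = 1"
    then obtain k where k: "d k = 1" ..
    then obtain v where v: "stepped A k (encode_rep ?p 0) = Suc v"
      by (cases "stepped A k (encode_rep ?p 0)") (simp_all add: d)
    with k obtain w where
      w: "stepped A k (prod_encode (quine_code (prod_encode (?h, pfst v)), 0)) = Suc w"
      by (cases "stepped A k (prod_encode (quine_code (prod_encode (?h, pfst v)), 0))")
        (simp_all add: d)
    have "v = encode_rep q M" using stepped_sound[OF v] q by simp
    then show "run A (encode_rep (quine h q) 0) \<noteq> None"
      using stepped_sound[OF w] hq by simp
  qed
  also have "\<dots> \<longleftrightarrow> a \<noteq> 0"
  proof -
    have "a = 0 \<longleftrightarrow> (\<forall>k. real (d k) / 2 ^ Suc k = 0)"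
      unfolding a_def by (rule suminf_eq_zero_iff[OF summable_binary[of d, OF d01]]) simp
    moreover have "real (d k) / 2 ^ Suc k = 0 \<longleftrightarrow> d k \<noteq> 1" for k
      using d01[of k] by auto
    ultimately show ?thesis by simp
  qed
  finally show False using gate by blast
qed

end
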